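(* Let $m,n$ be integers. (1) If $2\leq m\leq \frac{n}{2}$ and $\mathcal{L}$ is the set of all linear forests $L$ of size at least $m$ (that is, $e(L)\ge m$), then $$r(\widehat{K}_n,\mathcal{L})= n+ \lceil m/2\rceil.$$ (2) If $6\leq m\leq \frac{n}{2}$ and $\mathcal{L}'$ is the set of all $3$-linear forests $L$ of size at least $m$, then $$r(\widehat{K}_n,\mathcal{L}')= n+ \lceil m/2\rceil.$$
   Context: All graphs are finite, simple and undirected. The size $e(G)$ of a graph $G$ is its number of edges. $P_n$ denotes the path on $n$ vertices. The kipas $\widehat{K}_n$ is the graph on $n+1$ vertices obtained from the path $P_n$ by adding a new vertex (the center) adjacent to all vertices of the path. A linear forest is a vertex-disjoint union of paths; a $k$-linear forest is a linear forest each of whose components is a path of order (number of vertices) at least $k$. For a graph $G$ and a set $\mathcal{F}$ of graphs, the Ramsey number $r(G,\mathcal{F})$ is the minimum integer $N$ such that every red/blue edge-coloring of the complete graph $K_N$ contains either a red copy of $G$ or a blue copy of some graph in $\mathcal{F}$. Copies are subgraphs, not necessarily induced. *)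

theory Defs
  imports Complex_Main "HOL-Library.Ramsey" "HOL-Library.Extended_Nat"
begin

datatype 'a graph = Graph (verts: "'a set") (edges: "'a set set")

definition simple_graph :: "'a graph \<Rightarrow> bool" where
  "simple_graph G \<longleftrightarrow> finite (verts G) \<and> edges G \<subseteq> [verts G]\<^bsup>2\<^esup>"

definition num_edges :: "'a graph \<Rightarrow> nat" where
  "num_edges G = card (edges G)"

definition graph_iso :: "'a graph \<Rightarrow> 'b graph \<Rightarrow> bool" where
  "graph_iso G H \<longleftrightarrow>
    (\<exists>f. bij_betw f (verts G) (verts H) \<and> edges H = (\<lambda>e. f ` e) ` edges G)"

text \<open>A copy is a not necessarily induced subgraph, hence inclusion rather than equality
  for the images.\<close>

definition has_copy :: "'a graph \<Rightarrow> 'b graph \<Rightarrow> bool" where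
  "has_copy G H \<longleftrightarrow>
    (\<exists>f. inj_on f (verts H) \<and> f ` verts H \<subseteq> verts G \<and> (\<lambda>e. f ` e) ` edges H \<subseteq> edges G)"

definition complete_graph :: "nat \<Rightarrow> nat graph" where
  "complete_graph N = Graph {..<N} ([{..<N}]\<^bsup>2\<^esup>)"

definition path_graph :: "nat \<Rightarrow> nat graph" where
  "path_graph n = Graph {..<n} {{i, Suc i} |i. Suc i < n}"

text \<open>The center is the vertex \<open>n\<close>.\<close>

definition kipas :: "nat \<Rightarrow> nat graph" where
  "kipas n = Graph (insert n (verts (path_graph n)))
    (edges (path_graph n) \<union> {{i, n} |i. i \<in> verts (path_graph n)})"

definition is_path :: "'a graph \<Rightarrow> bool" where
  "is_path H \<longleftrightarrow> (\<exists>k\<ge>1. graph_iso (path_graph k) H)"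

text \<open>\<open>C\<close> is the set of components of \<open>L\<close>, all of them paths. Since paths are connected,
  \<open>C\<close> is determined by \<open>L\<close>. Paths of order 1 (isolated vertices) are allowed.\<close>

definition path_components :: "'a graph \<Rightarrow> 'a graph set \<Rightarrow> bool" where
  "path_components L C \<longleftrightarrow>
    finite C \<and> (\<forall>H\<in>C. is_path H) \<and>
    (\<forall>H\<in>C. \<forall>H'\<in>C. H \<noteq> H' \<longrightarrow> verts H \<inter> verts H' = {}) \<and>
    verts L = (\<Union>H\<in>C. verts H) \<and> edges L = (\<Union>H\<in>C. edges H)"

definition linear_forest :: "'a graph \<Rightarrow> bool" where
  "linear_forest L \<longleftrightarrow> (\<exists>C. path_components L C)"

definition k_linear_forest :: "nat \<Rightarrow> 'a graph \<Rightarrow> bool" where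
  "k_linear_forest k L \<longleftrightarrow> (\<exists>C. path_components L C \<and> (\<forall>H\<in>C. k \<le> card (verts H)))"

datatype colour = Red | Blue

text \<open>Only the values of a colouring on the edges of \<open>G\<close> matter.\<close>

definition colour_subgraph :: "'a graph \<Rightarrow> ('a set \<Rightarrow> colour) \<Rightarrow> colour \<Rightarrow> 'a graph" where
  "colour_subgraph G c x = Graph (verts G) {e \<in> edges G. c e = x}"

definition ramsey_arrow :: "nat \<Rightarrow> 'a graph \<Rightarrow> 'b graph set \<Rightarrow> bool" where
  "ramsey_arrow N G F \<longleftrightarrow>
    (\<forall>c. has_copy (colour_subgraph (complete_graph N) c Red) G \<or>
         (\<exists>H\<in>F. has_copy (colour_subgraph (complete_graph N) c Blue) H))"

text \<open>The value is taken in \<^typ>\<open>enat\<close> so that it is \<open>\<infinity>\<close> if no \<open>N\<close> qualifies; a finite value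
  is therefore attained.\<close>

definition ramsey_number :: "'a graph \<Rightarrow> 'b graph set \<Rightarrow> enat" where
  "ramsey_number G F = (INF N \<in> {N. ramsey_arrow N G F}. enat N)"

lemma ramsey_number_eq_enat_iff:
  "ramsey_number G F = enat N \<longleftrightarrow>
    ramsey_arrow N G F \<and> (\<forall>M. ramsey_arrow M G F \<longrightarrow> N \<le> M)"
proof
  assume eq: "ramsey_number G F = enat N"
  let ?S = "enat ` {N. ramsey_arrow N G F}"
  have "?S \<noteq> {}"
  proof
    assume "?S = {}"
    then have "ramsey_number G F = Inf ({} :: enat set)"
      by (simp only: ramsey_number_def)
    with eq show False by (simp add: Inf_enat_def)
  qed
  then have "Inf ?S \<in> ?S"
    by (meson all_not_in_conv wellorder_InfI)
  then have "ramsey_arrow N G F"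
    using eq by (auto simp: ramsey_number_def)
  moreover have "N \<le> M" if "ramsey_arrow M G F" for M
  proof -
    have "Inf ?S \<le> enat M" using that by (intro Inf_lower) auto
    then show ?thesis using eq by (simp add: ramsey_number_def)
  qed
  ultimately show "ramsey_arrow N G F \<and> (\<forall>M. ramsey_arrow M G F \<longrightarrow> N \<le> M)" by blast
next
  assume "ramsey_arrow N G F \<and> (\<forall>M. ramsey_arrow M G F \<longrightarrow> N \<le> M)"
  then show "ramsey_number G F = enat N"
    unfolding ramsey_number_def
    by (intro antisym INF_greatest INF_lower) auto
qed

lemma simple_path_graph: "simple_graph (path_graph n)"
  by (auto simp: simple_graph_def path_graph_def nsets_def card_insert_if)

lemma simple_kipas: "simple_graph (kipas n)"
  by (auto simp: simple_graph_def kipas_def path_graph_def nsets_def card_insert_if)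

lemma card_verts_kipas: "card (verts (kipas n)) = n + 1"
  by (simp add: kipas_def path_graph_def)

lemma simple_is_path:
  assumes "is_path H"
  shows "simple_graph H"
proof -
  obtain k f where f: "bij_betw f (verts (path_graph k)) (verts H)"
    "edges H = (\<lambda>e. f ` e) ` edges (path_graph k)"
    using assms by (auto simp: is_path_def graph_iso_def)
  have "finite (verts H)"
    using f(1) simple_path_graph[of k] bij_betw_finite by (auto simp: simple_graph_def)
  moreover have "f ` e \<in> [verts H]\<^bsup>2\<^esup>" if "e \<in> edges (path_graph k)" for e
  proof -
    have "e \<in> [verts (path_graph k)]\<^bsup>2\<^esup>"
      using that simple_path_graph[of k] by (auto simp: simple_graph_def)
    then show ?thesis
      using bij_betw_nsets[OF f(1), of 2] by (auto simp: bij_betw_def)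
  qed
  ultimately show ?thesis using f(2) by (auto simp: simple_graph_def)
qed

lemma simple_linear_forest:
  assumes "linear_forest L"
  shows "simple_graph L"
proof -
  obtain C where C: "path_components L C"
    using assms by (auto simp: linear_forest_def)
  have s: "finite (verts H)" "edges H \<subseteq> [verts H]\<^bsup>2\<^esup>" if "H \<in> C" for H
    using that C simple_is_path by (auto simp: path_components_def simple_graph_def)
  have "verts H \<subseteq> verts L" if "H \<in> C" for H
    using that C by (auto simp: path_components_def)
  then have "edges H \<subseteq> [verts L]\<^bsup>2\<^esup>" if "H \<in> C" for H
    using that s(2) nsets_mono by blast
  then show ?thesis
    using C s(1) by (auto simp: path_components_def simple_graph_def)
qed

end

theory Submission
  imports Defs "HOL-Library.Multiset"
begin

text \<open>
  Lower bound: colour all edges meeting a fixed set of \<open>\<lceil>m/2\<rceil> - 1\<close> vertices blue and the others red.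

  Upper bound, for \<open>3\<close>-linear forests and all \<open>m \<ge> 3\<close>: take a blue \<open>3\<close>-linear forest with the maximal
  number \<open>s < m\<close> of edges, and let \<open>R\<close> be the set of vertices outside it. The blue edges inside \<open>R\<close>
  form a matching. Call a forest vertex bad if it has a blue neighbour in \<open>R\<close>. By maximality
  bad vertices are neither ends of the paths nor consecutive on them, so there are at most \<open>s/2\<close>;
  and if the matching covers \<open>R\<close>, then only the centres of paths on five vertices can be bad, so
  there are at most \<open>s/4\<close>. Hence some \<open>v\<close> in \<open>R\<close> is joined in red to all other good vertices
  except possibly its partner in the matching, and at least \<open>n\<close> of those remain. They are spanned by
  a red path: the first ends of the forest paths form a red clique, so do the last ends, and these two
  cliques and the inner good vertices can be inserted into a red path through \<open>R\<close>.
  For \<open>m = 2\<close> there is at most one blue edge.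
\<close>

section \<open>Path systems as lists, and the subgraphs they yield\<close>

text \<open>Lists make cutting and joining paths plain list operations. The single condition
  \<open>distinct (concat ps)\<close> says both that no path repeats a vertex and that different
  paths share none.\<close>

definition path_system :: "('a \<Rightarrow> 'a \<Rightarrow> bool) \<Rightarrow> 'a set \<Rightarrow> nat \<Rightarrow> 'a list list \<Rightarrow> bool" where
  "path_system E V k ps \<longleftrightarrow> distinct (concat ps) \<and> set (concat ps) \<subseteq> V \<and>
    (\<forall>p\<in>set ps. k \<le> length p \<and> successively E p)"

definition system_size :: "'a list list \<Rightarrow> nat" where
  "system_size ps = (\<Sum>p\<leftarrow>ps. length p - 1)"

definition path_edges :: "'a list \<Rightarrow> 'a set set" where
  "path_edges p = {{p ! i, p ! Suc i} |i. Suc i < length p}"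

lemma card_path_edges:
  assumes "distinct p"
  shows "card (path_edges p) = length p - 1"
proof -
  have eq: "path_edges p = (\<lambda>i. {p ! i, p ! Suc i}) ` {..<length p - 1}"
    by (auto simp: path_edges_def)
  have "inj_on (\<lambda>i. {p ! i, p ! Suc i}) {..<length p - 1}"
    using assms by (auto intro!: inj_onI simp: doubleton_eq_iff nth_eq_iff_index_eq)
  then show ?thesis unfolding eq by (simp add: card_image)
qed

lemma is_path_list:
  assumes "distinct p" "p \<noteq> []"
  shows "is_path (Graph (set p) (path_edges p))"
proof -
  have "bij_betw ((!) p) {..<length p} (set p)"
    using assms by (intro bij_betw_nth) auto
  moreover have "path_edges p = (\<lambda>e. (!) p ` e) ` {{i, Suc i} |i. Suc i < length p}"
  proof -
    have "{{i, Suc i} |i. Suc i < length p} = (\<lambda>i. {i, Suc i}) ` {i. Suc i < length p}"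
      and "path_edges p = (\<lambda>i. {p ! i, p ! Suc i}) ` {i. Suc i < length p}"
      by (auto simp: path_edges_def)
    then show ?thesis by (simp add: image_image)
  qed
  ultimately have "graph_iso (path_graph (length p)) (Graph (set p) (path_edges p))"
    by (auto simp: graph_iso_def path_graph_def)
  then show ?thesis
    using assms(2) unfolding is_path_def by (metis Suc_leI One_nat_def length_greater_0_conv)
qed

lemma path_system_linear_forest:
  assumes "path_system E V k ps" "1 \<le> k"
  obtains L where "k_linear_forest k L" "num_edges L = system_size ps" "verts L \<subseteq> V"
    "edges L \<subseteq> {{x, y} |x y. x \<in> V \<and> y \<in> V \<and> x \<noteq> y \<and> E x y}"
proof -
  have d: "distinct (concat ps)" and V: "set (concat ps) \<subseteq> V"
    and k: "\<And>p. p \<in> set ps \<Longrightarrow> k \<le> length p" and E: "\<And>p. p \<in> set ps \<Longrightarrow> successively E p"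
    using assms(1) by (auto simp: path_system_def)
  have ne: "p \<noteq> []" if "p \<in> set ps" for p
    using k[OF that] assms(2) by auto
  have dp: "distinct p" if "p \<in> set ps" for p
    using d that by (auto simp: distinct_concat_iff)
  \<comment> \<open>\<open>distinct_concat_iff\<close> gives distinctness of the members only after
    empty lists are removed, since these could be repeated. As \<open>1 \<le> k\<close>, there are
    none.\<close>
  have "removeAll [] ps = ps" using ne by (intro removeAll_id) auto
  then have dps: "distinct ps" and
    disj: "\<And>p q. p \<in> set ps \<Longrightarrow> q \<in> set ps \<Longrightarrow> p \<noteq> q \<Longrightarrow> set p \<inter> set q = {}"
    using d by (auto simp: distinct_concat_iff)
  let ?G = "\<lambda>p. Graph (set p) (path_edges p)"
  let ?L = "Graph (set (concat ps)) (\<Union>p\<in>set ps. path_edges p)"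
  have pe: "e \<subseteq> set p \<and> e \<noteq> {}" if "e \<in> path_edges p" for e and p :: "'a list"
    using that by (auto simp: path_edges_def)
  have "path_components ?L (?G ` set ps)"
    unfolding path_components_def using is_path_list[OF dp ne] disj by fastforce
  moreover have "\<forall>H\<in>?G ` set ps. k \<le> card (verts H)"
    using k dp by (auto simp: distinct_card)
  ultimately have "k_linear_forest k ?L" unfolding k_linear_forest_def by blast
  moreover have "num_edges ?L = system_size ps"
  proof -
    have "card (\<Union>p\<in>set ps. path_edges p) = (\<Sum>p\<in>set ps. card (path_edges p))"
    proof (rule card_UN_disjoint)
      show "\<forall>p\<in>set ps. finite (path_edges p)"
        using pe by (auto intro: finite_subset[OF _ finite_Pow_iff[THEN iffD2, OF finite_set]])
      show "\<forall>p\<in>set ps. \<forall>q\<in>set ps. p \<noteq> q \<longrightarrow> path_edges p \<inter> path_edges q = {}"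
        using pe disj by blast
    qed simp
    also have "\<dots> = (\<Sum>p\<in>set ps. length p - 1)" using dp by (simp add: card_path_edges)
    finally show ?thesis
      using dps by (simp add: num_edges_def system_size_def sum_list_distinct_conv_sum_set)
  qed
  moreover have "edges ?L \<subseteq> {{x, y} |x y. x \<in> V \<and> y \<in> V \<and> x \<noteq> y \<and> E x y}"
  proof
    fix e assume "e \<in> edges ?L"
    then obtain p i where p: "p \<in> set ps" "Suc i < length p" "e = {p ! i, p ! Suc i}"
      by (auto simp: path_edges_def)
    have "p ! i \<noteq> p ! Suc i" using dp[OF p(1)] p(2) by (simp add: nth_eq_iff_index_eq)
    moreover have "E (p ! i) (p ! Suc i)"
      using E[OF p(1)] p(2) by (auto simp: successively_conv_nth)
    moreover have "p ! i \<in> set p" "p ! Suc i \<in> set p" using p(2) by simp_all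
    then have "p ! i \<in> V" "p ! Suc i \<in> V" using V p(1) by auto
    ultimately show "e \<in> {{x, y} |x y. x \<in> V \<and> y \<in> V \<and> x \<noteq> y \<and> E x y}"
      using p(3) by blast
  qed
  ultimately show ?thesis using that[of ?L] V by simp
qed

lemma has_copy_path_system:
  fixes c :: "nat set \<Rightarrow> colour"
  assumes "path_system (\<lambda>x y. c {x, y} = x0) {..<N} k ps" "1 \<le> k"
  obtains L :: "nat graph" where "k_linear_forest k L" "num_edges L = system_size ps"
    "has_copy (colour_subgraph (complete_graph N) c x0) L"
proof -
  obtain L where L: "k_linear_forest k L" "num_edges L = system_size ps" "verts L \<subseteq> {..<N}"
    "edges L \<subseteq> {{x, y} |x y. x \<in> {..<N} \<and> y \<in> {..<N} \<and> x \<noteq> y \<and> c {x, y} = x0}"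
    by (rule path_system_linear_forest[OF assms])
  have "edges L \<subseteq> {e \<in> [{..<N}]\<^bsup>2\<^esup>. c e = x0}"
    by (rule subset_trans[OF L(4)]) (auto simp: nsets_def)
  then have "has_copy (colour_subgraph (complete_graph N) c x0) L"
    unfolding has_copy_def colour_subgraph_def complete_graph_def
    by (intro exI[of _ id]) (use L(3) in auto)
  then show ?thesis using that L(1,2) by blast
qed

lemma has_copy_kipas:
  assumes "length zs = n" "distinct zs" "set zs \<subseteq> {..<N}" "v < N" "v \<notin> set zs"
    and "successively (\<lambda>x y. c {x, y} = x0) zs" "\<And>z. z \<in> set zs \<Longrightarrow> c {v, z} = x0"
  shows "has_copy (colour_subgraph (complete_graph N) c x0) (kipas n)"
proof -
  define f where "f i = (if i < n then zs ! i else v)" for i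
  have f: "i < n \<Longrightarrow> f i = zs ! i" "f n = v" for i by (auto simp: f_def)
  have "inj_on f {..n}"
    using assms(1,2,5) by (auto intro!: inj_onI simp: f_def nth_eq_iff_index_eq le_less split: if_splits)
  moreover have "verts (kipas n) = {..n}" by (auto simp: kipas_def path_graph_def)
  moreover have "f ` {..n} \<subseteq> {..<N}"
    using assms(1,3,4) by (auto simp: f_def subset_iff)
  moreover have "f ` e \<in> {e \<in> [{..<N}]\<^bsup>2\<^esup>. c e = x0}" if "e \<in> edges (kipas n)" for e
  proof -
    have zs: "i < n \<Longrightarrow> zs ! i \<in> set zs" for i using assms(1) by simp
    consider i where "Suc i < n" "e = {i, Suc i}" | i where "i < n" "e = {i, n}"
      using \<open>e \<in> edges (kipas n)\<close> by (auto simp: kipas_def path_graph_def)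
    then show ?thesis
    proof cases
      case 1
      have "zs ! i \<noteq> zs ! Suc i" using 1 assms(1,2) by (simp add: nth_eq_iff_index_eq)
      moreover have "c {zs ! i, zs ! Suc i} = x0"
        using 1 assms(1,6) by (auto simp: successively_conv_nth)
      ultimately show ?thesis
        using 1 zs[of i] zs[of "Suc i"] assms(3) by (auto simp: f nsets_def)
    next
      case 2
      have "zs ! i \<noteq> v" using 2 zs assms(5) by metis
      moreover have "c {v, zs ! i} = x0" using 2 zs assms(7) by blast
      ultimately show ?thesis
        using 2 zs[of i] assms(3,4) by (auto simp: f nsets_def insert_commute)
    qed
  qed
  ultimately show ?thesis
    unfolding has_copy_def colour_subgraph_def complete_graph_def
    by (intro exI[of _ f]) auto
qed

section \<open>Permuting, counting and ordering lists\<close>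

lemma path_system_append:
  "path_system E V k (ps @ qs) \<longleftrightarrow> path_system E V k ps \<and> path_system E V k qs \<and>
    set (concat ps) \<inter> set (concat qs) = {}"
  by (auto simp: path_system_def)

lemma system_size_append: "system_size (ps @ qs) = system_size ps + system_size qs"
  by (simp add: system_size_def)

lemma path_system_perm:
  assumes "mset ps = mset qs"
  shows "path_system E V k ps \<longleftrightarrow> path_system E V k qs"
proof -
  have "mset (concat ps) = mset (concat qs)"
    using assms by (simp add: mset_concat flip: sum_mset_sum_list)
  then have "distinct (concat ps) \<longleftrightarrow> distinct (concat qs)" by (rule mset_eq_imp_distinct_iff)
  then show ?thesis using mset_eq_setD[OF assms] by (simp add: path_system_def)
qed

lemma system_size_perm:
  assumes "mset ps = mset qs"
  shows "system_size ps = system_size qs"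
proof -
  have "mset (map (\<lambda>p. length p - 1) ps) = mset (map (\<lambda>p. length p - 1) qs)"
    using assms by simp
  then show ?thesis unfolding system_size_def by (metis sum_mset_sum_list)
qed

text \<open>Two entries in \<open>B\<close> always have an entry outside \<open>B\<close> between
  them, so the count is at most half of \<open>length xs + 1\<close>, attained only if both ends lie
  in \<open>B\<close>. The two indicator terms record the saving at each end that lies outside
  \<open>B\<close>.\<close>

lemma twice_filter_le_length:
  assumes "xs \<noteq> []" "successively (\<lambda>x y. \<not> (x \<in> B \<and> y \<in> B)) xs"
  shows "2 * length (filter (\<lambda>x. x \<in> B) xs) + of_bool (hd xs \<notin> B) + of_bool (last xs \<notin> B)
    \<le> length xs + 1"
  using assms
proof (induction xs)
  case (Cons x xs)
  then show ?case by (cases xs) (auto split: if_splits)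
qed simp

text \<open>Each block goes into the gap just before one entry of \<open>us\<close>. Gap entries and
  block entries are compatible in both orders, so every such insertion is allowed; the old adjacency
  in \<open>x # us\<close> serves the gaps left free and the empty blocks. Keeping \<open>x\<close>
  in front lets the induction attach what precedes it.\<close>

lemma interleave_Cons:
  assumes "length bs \<le> length us" "successively P (x # us)"
    and "\<And>b. b \<in> set bs \<Longrightarrow> successively P b"
    and "\<And>u w. u \<in> set (x # us) \<Longrightarrow> w \<in> set (concat bs) \<Longrightarrow> P u w \<and> P w u"
  shows "\<exists>zs. mset zs = mset us + mset (concat bs) \<and> successively P (x # zs)"
  using assms
proof (induction us arbitrary: bs x)
  case Nil
  then show ?case by auto
next
  case (Cons u us)
  show ?case
  proof (cases bs)
    case Nil
    then show ?thesis using Cons.prems(2) by (intro exI[of _ "u # us"]) auto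
  next
    case (Cons b bs')
    have "\<exists>zs. mset zs = mset us + mset (concat bs') \<and> successively P (u # zs)"
      using Cons.prems Cons by (intro Cons.IH) auto
    then obtain zs where zs: "mset zs = mset us + mset (concat bs')" "successively P (u # zs)"
      by blast
    have b: "successively P b" using Cons.prems(3) Cons by simp
    have "P x w \<and> P w u" if "w \<in> set b" for w
      using that Cons.prems(4)[of x w] Cons.prems(4)[of u w] Cons by auto
    then have "successively P (x # b @ u # zs)"
      using zs(2) b Cons.prems(2)
      by (cases "b = []") (auto simp: successively_Cons successively_append_iff)
    then show ?thesis
      using zs(1) Cons by (intro exI[of _ "b @ u # zs"]) auto
  qed
qed

text \<open>The first block is put before the whole list and the others into the gaps, so as many
  blocks as entries fit. The multiset equation later gives both the vertex set and
  distinctness.\<close>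

lemma interleave:
  assumes "length bs \<le> length us" "successively P us"
    and "\<And>b. b \<in> set bs \<Longrightarrow> successively P b"
    and "\<And>u w. u \<in> set us \<Longrightarrow> w \<in> set (concat bs) \<Longrightarrow> P u w \<and> P w u"
  shows "\<exists>zs. mset zs = mset us + mset (concat bs) \<and> successively P zs"
proof (cases bs)
  case Nil
  then show ?thesis using assms(2) by auto
next
  case (Cons b bs')
  then obtain u us' where us: "us = u # us'" using assms(1) by (cases us) auto
  have "\<exists>zs. mset zs = mset us' + mset (concat bs') \<and> successively P (u # zs)"
    using assms Cons us by (intro interleave_Cons) auto
  then obtain zs where zs: "mset zs = mset us' + mset (concat bs')" "successively P (u # zs)"
    by blast
  have "successively P (b @ u # zs)"
    using zs(2) assms(3)[of b] assms(4)[of u "last b"] Cons us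
    by (cases "b = []") (auto simp: successively_append_iff)
  then show ?thesis using zs(1) Cons us by (intro exI[of _ "b @ u # zs"]) auto
qed

text \<open>Consider a longest path in the complement of the matching. A vertex outside it would be
  matched to both of its ends, so these coincide, which leaves at most two vertices.\<close>

lemma complement_matching_path:
  assumes "finite S" "card S \<ge> 3"
    and sym: "\<And>x y. E x y \<Longrightarrow> E y x"
    and match: "\<And>x y z. x \<in> S \<Longrightarrow> y \<in> S \<Longrightarrow> z \<in> S \<Longrightarrow> x \<noteq> y \<Longrightarrow> x \<noteq> z \<Longrightarrow> E x y \<Longrightarrow> E x z \<Longrightarrow> y = z"
  shows "\<exists>us. distinct us \<and> set us = S \<and> successively (\<lambda>x y. \<not> E x y) us"
proof -
  let ?P = "\<lambda>us. distinct us \<and> set us \<subseteq> S \<and> successively (\<lambda>x y. \<not> E x y) us"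
  have bound: "length us < card S + 1" if "?P us" for us
    using that assms(1) by (metis distinct_card card_mono less_Suc_eq_le Suc_eq_plus1)
  obtain us where us: "?P us" and max: "\<And>vs. ?P vs \<Longrightarrow> length vs \<le> length us"
    using ex_has_greatest_nat[of ?P "[]" length "card S + 1"] bound by force
  have "set us = S"
  proof (rule ccontr)
    assume "set us \<noteq> S"
    then obtain z where z: "z \<in> S" "z \<notin> set us" using us by blast
    have "us \<noteq> []" using max[of "[z]"] z by auto
    then have ends: "hd us \<in> set us" "last us \<in> set us" by auto
    have "E z (hd us)" using max[of "z # us"] us z by (auto simp: successively_Cons)
    moreover have "E (last us) z"
      using max[of "us @ [z]"] us z by (auto simp: successively_append_iff)
    then have "E z (last us)" by (rule sym)
    ultimately have "hd us = last us" using match[of z] z ends us by auto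
    then have "length us \<le> 1"
      using us \<open>us \<noteq> []\<close> by (cases us) (auto split: if_splits)
    with \<open>us \<noteq> []\<close> obtain a where a: "us = [a]" by (cases us) auto
    have "\<not> S \<subseteq> {a, z}"
      using assms(2) card_mono[of "{a, z}" S] card_insert_le_m1[of 2 "{z}" a] by auto
    then obtain b where b: "b \<in> S" "b \<noteq> a" "b \<noteq> z" by blast
    have "E a b" using max[of "[a, b]"] b a us by auto
    moreover have "E a z" using max[of "[a, z]"] z a us by auto
    ultimately show False using match[of a b z] b a us z by auto
  qed
  then show ?thesis using us by blast
qed


section \<open>The lower bound\<close>

lemma is_path_degree:
  assumes "is_path H"
  shows "card {e \<in> edges H. x \<in> e} \<le> 2"
proof -
  obtain k f where f: "bij_betw f {..<k} (verts H)"
    "edges H = (\<lambda>e. f ` e) ` {{i, Suc i} |i. Suc i < k}"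
    using assms by (auto simp: is_path_def graph_iso_def path_graph_def)
  have inj: "inj_on f {..<k}" using f(1) by (simp add: bij_betw_def)
  show ?thesis
  proof (cases "\<exists>j<k. f j = x")
    case True
    then obtain j where j: "j < k" "f j = x" by blast
    \<comment> \<open>For \<open>j = 0\<close> the truncated \<open>j - 1\<close> yields the
      singleton \<open>{f 0}\<close>, which is harmless because only an inclusion is
      claimed.\<close>
    have "{e \<in> edges H. x \<in> e} \<subseteq> {{f (j - 1), f j}, {f j, f (Suc j)}}"
    proof
      fix e assume "e \<in> {e \<in> edges H. x \<in> e}"
      then obtain i where i: "Suc i < k" "e = {f i, f (Suc i)}" "x = f i \<or> x = f (Suc i)"
        by (auto simp: f(2))
      then have "j = i \<or> j = Suc i"
        using inj j by (auto dest!: inj_onD)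
      then show "e \<in> {{f (j - 1), f j}, {f j, f (Suc j)}}" using i(2) by auto
    qed
    then have "card {e \<in> edges H. x \<in> e} \<le> card {{f (j - 1), f j}, {f j, f (Suc j)}}"
      by (rule card_mono[rotated]) simp
    also have "\<dots> \<le> 2" by (simp add: card_insert_if)
    finally show ?thesis .
  next
    case False
    then have "{e \<in> edges H. x \<in> e} = {}" by (auto simp: f(2) dest: Suc_lessD)
    then show ?thesis by (metis card.empty le0)
  qed
qed

text \<open>The components are vertex-disjoint, so all edges at \<open>x\<close> belong to the one
  path containing \<open>x\<close>.\<close>

lemma linear_forest_degree:
  assumes "linear_forest L"
  shows "card {e \<in> edges L. x \<in> e} \<le> 2"
proof -
  obtain C where C: "path_components L C" using assms by (auto simp: linear_forest_def)
  have sub: "e \<subseteq> verts H" if "H \<in> C" "e \<in> edges H" for H e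
    using that C simple_is_path by (fastforce simp: path_components_def simple_graph_def nsets_def)
  show ?thesis
  proof (cases "\<exists>H\<in>C. x \<in> verts H")
    case True
    then obtain H where H: "H \<in> C" "x \<in> verts H" by blast
    have "{e \<in> edges L. x \<in> e} \<subseteq> {e \<in> edges H. x \<in> e}"
    proof
      fix e assume "e \<in> {e \<in> edges L. x \<in> e}"
      then obtain H' where H': "H' \<in> C" "e \<in> edges H'" "x \<in> e"
        using C by (auto simp: path_components_def)
      then have "x \<in> verts H'" using sub by blast
      then have "H' = H" using H H'(1) C unfolding path_components_def by blast
      then show "e \<in> {e \<in> edges H. x \<in> e}" using H' by simp
    qed
    moreover have "is_path H" using H C by (auto simp: path_components_def)
    moreover have "finite {e \<in> edges H. x \<in> e}"
      using simple_is_path[OF \<open>is_path H\<close>]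
      by (auto simp: simple_graph_def intro: finite_subset finite_imp_finite_nsets)
    ultimately show ?thesis
      using is_path_degree[of H x] card_mono order_trans by blast
  next
    case False
    have "x \<notin> e" if e: "e \<in> edges L" for e
    proof -
      obtain H where "H \<in> C" "e \<in> edges H" using e C by (auto simp: path_components_def)
      then show ?thesis using sub[of H e] False by blast
    qed
    then have "{e \<in> edges L. x \<in> e} = {}" by blast
    then show ?thesis by (metis card.empty le0)
  qed
qed

text \<open>A red kipas has to avoid the \<open>k\<close> special vertices, which leaves at most
  \<open>n\<close> of them for its \<open>n + 1\<close> vertices. In a blue linear forest every edge
  meets a special vertex, each of which lies on at most two edges, so there are at most
  \<open>2 * k < m\<close> edges. The family \<open>F\<close> is left general to serve both parts of
  the theorem.\<close>

lemma ramsey_lower: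
  assumes "1 \<le> n" "1 \<le> m" "\<And>L. L \<in> F \<Longrightarrow> linear_forest L \<and> m \<le> num_edges L"
    and arrow: "ramsey_arrow M (kipas n) F"
  shows "n + (m + 1) div 2 \<le> M"
proof (rule ccontr)
  define k where "k = (m + 1) div 2 - 1"
  assume "\<not> n + (m + 1) div 2 \<le> M"
  then have M: "M \<le> n + k" and k: "2 * k < m" using assms(2) by (auto simp: k_def)
  define c where "c e = (if \<exists>x\<in>e. x < k then Blue else Red)" for e :: "nat set"
  consider "has_copy (colour_subgraph (complete_graph M) c Red) (kipas n)" |
    L where "L \<in> F" "has_copy (colour_subgraph (complete_graph M) c Blue) L"
    using arrow unfolding ramsey_arrow_def by blast
  then show False
  proof cases
    case 1
    then obtain f where f: "inj_on f {..n}" "f ` {..n} \<subseteq> {..<M}"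
      "\<And>e. e \<in> edges (kipas n) \<Longrightarrow> c (f ` e) = Red"
      unfolding has_copy_def colour_subgraph_def complete_graph_def
      by (auto simp: kipas_def path_graph_def image_subset_iff lessThan_Suc_atMost[symmetric] lessThan_Suc)
    \<comment> \<open>No vertex of the kipas is isolated: a path vertex lies on its spoke, and the
      center on the spoke \<open>{0, n}\<close>, which exists as \<open>1 \<le> n\<close>. An edge
      at a special vertex would be blue.\<close>
    have "\<not> f i < k" if "i \<le> n" for i
    proof -
      obtain e where "e \<in> edges (kipas n)" "i \<in> e"
      proof (cases "i < n")
        case True
        then show ?thesis using that[of "{i, n}"] by (auto simp: kipas_def path_graph_def)
      next
        case False
        moreover have "{0, n} \<in> edges (kipas n)"
          using assms(1) by (auto simp: kipas_def path_graph_def intro!: exI[of _ 0])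
        ultimately show ?thesis using that[of "{0, n}"] \<open>i \<le> n\<close> by auto
      qed
      then show ?thesis using f(3)[of e] by (auto simp: c_def split: if_splits)
    qed
    then have "f ` {..n} \<subseteq> {k..<M}" using f(2) by force
    then have "card {..n} \<le> card {k..<M}"
      using card_inj_on_le[OF f(1)] by blast
    then show False using M by simp
  next
    case 2
    then obtain f where f: "inj_on f (verts L)" and
      "(\<lambda>e. f ` e) ` edges L \<subseteq> {e \<in> [{..<M}]\<^bsup>2\<^esup>. c e = Blue}"
      unfolding has_copy_def colour_subgraph_def complete_graph_def by auto
    then have blue: "c (f ` e) = Blue" if "e \<in> edges L" for e using that by blast
    have lf: "linear_forest L" and m: "m \<le> card (edges L)"
      using assms(3)[OF 2(1)] by (auto simp: num_edges_def)
    let ?X = "{x \<in> verts L. f x < k}"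
    have X: "card ?X \<le> k"
      using card_inj_on_le[of f ?X "{..<k}"] inj_on_subset[OF f, of ?X] by auto
    have sg: "simple_graph L" using lf by (rule simple_linear_forest)
    then have finX: "finite ?X" by (simp add: simple_graph_def)
    have "edges L \<subseteq> (\<Union>x\<in>?X. {e \<in> edges L. x \<in> e})"
    proof
      fix e assume e: "e \<in> edges L"
      then have "e \<subseteq> verts L" using sg by (auto simp: simple_graph_def nsets_def)
      moreover have "\<exists>x\<in>e. f x < k" using blue[OF e] by (auto simp: c_def split: if_splits)
      ultimately show "e \<in> (\<Union>x\<in>?X. {e \<in> edges L. x \<in> e})" using e by blast
    qed
    moreover have "finite (edges L)"
      using sg by (auto simp: simple_graph_def intro: finite_subset finite_imp_finite_nsets)
    then have "finite (\<Union>x\<in>?X. {e \<in> edges L. x \<in> e})" using finX by simp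
    ultimately have "card (edges L) \<le> card (\<Union>x\<in>?X. {e \<in> edges L. x \<in> e})"
      using card_mono by blast
    also have "\<dots> \<le> (\<Sum>x\<in>?X. card {e \<in> edges L. x \<in> e})" using finX by (rule card_UN_le)
    also have "\<dots> \<le> (\<Sum>x\<in>?X. 2)" by (intro sum_mono linear_forest_degree lf)
    also have "\<dots> \<le> 2 * k" using X by simp
    finally show False using m k by simp
  qed
qed

section \<open>Exchange arguments for a maximal path system\<close>

text \<open>\<open>E\<close> will be blue adjacency, \<open>E x y\<close> meaning
  \<open>c {x, y} = Blue\<close>. A colouring is arbitrary on singletons, so \<open>E x x\<close>
  may hold; this is why vertices are explicitly required to be distinct below.\<close>

locale optimal_system =
  fixes E :: "'a \<Rightarrow> 'a \<Rightarrow> bool" and V :: "'a set" and ps :: "'a list list"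
  assumes finV: "finite V" and sym: "E x y \<Longrightarrow> E y x"
    and system: "path_system E V 3 ps"
    and optimal: "path_system E V 3 qs \<Longrightarrow> system_size qs \<le> system_size ps"
begin

lemma sym_eq: "E x y \<longleftrightarrow> E y x"
  using sym by blast

abbreviation "S \<equiv> set (concat ps)"
abbreviation "R \<equiv> V - S"
definition "Bad = {x \<in> S. \<exists>u\<in>R. E u x}"

lemma path:
  assumes "p \<in> set ps"
  shows "3 \<le> length p" "successively E p" "distinct p" "set p \<subseteq> V" "set p \<subseteq> S"
  using system assms by (auto simp: path_system_def distinct_concat_iff)

lemma disjoint: "p \<in> set ps \<Longrightarrow> q \<in> set ps \<Longrightarrow> p \<noteq> q \<Longrightarrow> set p \<inter> set q = {}"
  using system by (auto simp: path_system_def distinct_concat_iff)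

text \<open>The source of all structure below: a subsystem \<open>ps1\<close>, wherever its members
  stand in \<open>ps\<close>, may be rebuilt from its own vertices and outside vertices, and
  maximality forbids any gain of edges.\<close>

lemma exchange:
  assumes "mset ps = mset (ps1 @ ps2)" "path_system E V 3 qs" "set (concat qs) \<subseteq> set (concat ps1) \<union> R"
  shows "system_size qs \<le> system_size ps1"
proof -
  have ps: "path_system E V 3 (ps1 @ ps2)" using system path_system_perm[OF assms(1)] by blast
  have "S = set (concat (ps1 @ ps2))" using mset_eq_setD[OF assms(1)] by auto
  then have "set (concat qs) \<inter> set (concat ps2) = {}"
    using assms(3) ps by (auto simp: path_system_append)
  then have "path_system E V 3 (qs @ ps2)"
    using assms(2) ps unfolding path_system_append by blast
  from optimal[OF this] show ?thesis
    using system_size_perm[OF assms(1)] by (simp add: system_size_append)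
qed

lemma exchange_one:
  assumes "p \<in> set ps" "path_system E V 3 qs" "set (concat qs) \<subseteq> set p \<union> R"
  shows "system_size qs \<le> length p - 1"
proof -
  have "mset ps = mset ([p] @ remove1 p ps)" using assms(1) by simp
  from exchange[OF this assms(2)] show ?thesis using assms(3) by (simp add: system_size_def)
qed

lemma outside_matching:
  assumes "u \<in> R" "x \<in> R" "y \<in> R" "u \<noteq> x" "u \<noteq> y" "E u x" "E u y"
  shows "x = y"
proof (rule ccontr)
  assume "x \<noteq> y"
  then have "path_system E V 3 [[x, u, y]]"
    using assms sym[of u x] by (auto simp: path_system_def)
  \<comment> \<open>The new path lies wholly in \<open>R\<close>, so it is added without replacing
    anything.\<close>
  moreover have "mset ps = mset ([] @ ps)" by simp
  moreover have "set (concat [[x, u, y]]) \<subseteq> set (concat []) \<union> R" using assms by simp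
  ultimately have "system_size [[x, u, y]] \<le> system_size ([] :: 'a list list)" using exchange by blast
  then show False by (simp add: system_size_def)
qed

lemma outside_not_adjacent_hd:
  assumes "p \<in> set ps" "u \<in> R"
  shows "\<not> E u (hd p)"
proof
  assume "E u (hd p)"
  then have "path_system E V 3 [u # p]"
    using assms path[OF assms(1)] by (auto simp: path_system_def successively_Cons)
  then have "system_size [u # p] \<le> length p - 1"
    by (intro exchange_one[OF assms(1)]) (use assms in auto)
  then show False using path(1)[OF assms(1)] by (simp add: system_size_def)
qed

lemma rev_path: "successively E (rev p) \<longleftrightarrow> successively E p"
  by (simp add: sym_eq)

lemma outside_not_adjacent_last:
  assumes "p \<in> set ps" "u \<in> R"
  shows "\<not> E u (last p)"
proof
  assume "E u (last p)"
  then have "path_system E V 3 [p @ [u]]"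
    using assms path[OF assms(1)] sym[of u "last p"]
    by (auto simp: path_system_def successively_append_iff)
  then have "system_size [p @ [u]] \<le> length p - 1"
    by (intro exchange_one[OF assms(1)]) (use assms in auto)
  then show False using path(1)[OF assms(1)] by (simp add: system_size_def)
qed

text \<open>If \<open>u = u'\<close>, this vertex can be inserted between \<open>a\<close> and
  \<open>b\<close>. Otherwise the edge between \<open>a\<close> and \<open>b\<close> is given up for
  the two edges to \<open>u\<close> and \<open>u'\<close>. Either way one edge is gained.\<close>

lemma outside_not_adjacent_consecutive:
  assumes "xs @ a # b # ys \<in> set ps" "u \<in> R" "u' \<in> R" "E u a" "E u' b"
  shows False
proof -
  let ?p = "xs @ a # b # ys"
  note p = path[OF assms(1)]
  \<comment> \<open>Neither \<open>a\<close> nor \<open>b\<close> is an end of the path, so both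
    pieces of the cut path will have at least three vertices.\<close>
  have ne: "xs \<noteq> []" "ys \<noteq> []"
    using outside_not_adjacent_hd[OF assms(1,2)] outside_not_adjacent_last[OF assms(1,3)] assms(4,5) by auto
  have u: "u \<notin> set ?p" "u' \<notin> set ?p" "u \<in> V" "u' \<in> V" using p(5) assms(2,3) by auto
  show False
  proof (cases "u = u'")
    case True
    have "path_system E V 3 [xs @ a # u # b # ys]"
      using p ne u True assms(4,5) sym[of u a]
      by (auto simp: path_system_def successively_append_iff successively_Cons)
    then have "system_size [xs @ a # u # b # ys] \<le> length ?p - 1"
      by (intro exchange_one[OF assms(1)]) (use assms in auto)
    then show False by (simp add: system_size_def)
  next
    case False
    have "path_system E V 3 [xs @ [a, u], u' # b # ys]"
      using p ne u False assms(4,5) sym[of u a]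
      by (auto simp: path_system_def successively_append_iff successively_Cons Suc_le_eq)
    then have "system_size [xs @ [a, u], u' # b # ys] \<le> length ?p - 1"
      by (intro exchange_one[OF assms(1)]) (use assms in auto)
    then show False by (simp add: system_size_def)
  qed
qed

text \<open>After reversing one of the two paths, the edge would join them into one path with an
  additional edge. Hence the first ends form a clique in the complement of \<open>E\<close>, and so
  do the last ends.\<close>

lemma ends_not_adjacent:
  assumes "p \<in> set ps" "q \<in> set ps" "p \<noteq> q"
  shows "\<not> E (hd p) (hd q)" "\<not> E (last p) (last q)"
proof -
  note P = path[OF assms(1)] and Q = path[OF assms(2)]
  have ne: "p \<noteq> []" "q \<noteq> []" using P(1) Q(1) by auto
  have disj: "set p \<inter> set q = {}" using disjoint assms by blast
  have remove1: "mset xs = mset (x # remove1 x xs)" if "x \<in> set xs" for x :: "'a list" and xs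
    using that by simp
  have "q \<in> set (remove1 p ps)" using assms by (simp add: in_set_remove1)
  then have perm: "mset ps = mset ([p, q] @ remove1 q (remove1 p ps))"
    using remove1[OF assms(1)] remove1[of q "remove1 p ps"]
    by (simp only: append_Cons append_Nil mset.simps)
  have no: False if "path_system E V 3 [r]" "set r \<subseteq> set p \<union> set q" "length r = length p + length q" for r
  proof -
    have "system_size [r] \<le> system_size [p, q]"
      by (rule exchange[OF perm that(1)]) (use that(2) in auto)
    then show False using that(3) ne by (cases p; cases q) (auto simp: system_size_def)
  qed
  show "\<not> E (hd p) (hd q)"
  proof
    assume "E (hd p) (hd q)"
    then have "path_system E V 3 [rev p @ q]"
      using P Q ne disj rev_path[of p]
      by (auto simp: path_system_def successively_append_iff last_rev simp del: successively_rev)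
    then show False by (rule no) auto
  qed
  show "\<not> E (last p) (last q)"
  proof
    assume "E (last p) (last q)"
    then have "path_system E V 3 [p @ rev q]"
      using P Q ne disj rev_path[of q]
      by (auto simp: path_system_def successively_append_iff hd_rev simp del: successively_rev)
    then show False by (rule no) auto
  qed
qed

text \<open>Here \<open>u u'\<close> is a blue edge hanging at \<open>a\<close>: with either half of the path it
  forms a longer path, unless both halves have exactly two vertices.\<close>

lemma pendant_edge:
  assumes "xs @ a # ys \<in> set ps" "u \<in> R" "u' \<in> R" "u \<noteq> u'" "E u a" "E u u'"
  shows "length xs = 2 \<and> length ys = 2"
proof -
  let ?p = "xs @ a # ys"
  note p = path[OF assms(1)]
  have u: "u \<notin> set ?p" "u' \<notin> set ?p" "u \<in> V" "u' \<in> V" using p(5) assms(2,3) by auto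
  have xs: "path_system E V 3 [xs @ [a, u, u']]"
    using p u assms(4-6) sym[of u a]
    by (auto simp: path_system_def successively_append_iff successively_Cons)
  have ys: "path_system E V 3 [u' # u # a # ys]"
    using p u assms(4-6) sym[of u u']
    by (auto simp: path_system_def successively_append_iff successively_Cons)
  have 1: "length xs + 2 \<le> length ?p - 1"
    using exchange_one[OF assms(1) xs] assms by (auto simp: system_size_def)
  have 2: "length ys + 2 \<le> length ?p - 1"
    using exchange_one[OF assms(1) ys] assms by (auto simp: system_size_def)
  have 3: "length ys < 3"
  proof (rule ccontr)
    assume "\<not> length ys < 3"
    then have "path_system E V 3 [xs @ [a, u, u'], ys]"
      using p xs u by (auto simp: path_system_def successively_append_iff successively_Cons)
    then have "system_size [xs @ [a, u, u'], ys] \<le> length ?p - 1"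
      by (intro exchange_one[OF assms(1)]) (use assms in auto)
    then show False using \<open>\<not> length ys < 3\<close> by (simp add: system_size_def)
  qed
  have 4: "length xs < 3"
  proof (rule ccontr)
    assume "\<not> length xs < 3"
    then have "path_system E V 3 [u' # u # a # ys, xs]"
      using p ys u by (auto simp: path_system_def successively_append_iff successively_Cons)
    then have "system_size [u' # u # a # ys, xs] \<le> length ?p - 1"
      by (intro exchange_one[OF assms(1)]) (use assms in auto)
    then show False using \<open>\<not> length xs < 3\<close> by (simp add: system_size_def)
  qed
  show ?thesis using 1 2 3 4 by simp
qed

section \<open>Counting bad vertices\<close>

lemma filter_Bad_le:
  assumes "p \<in> set ps"
  shows "2 * length (filter (\<lambda>x. x \<in> Bad) p) \<le> length p - 1"
proof -
  note p = path[OF assms]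
  have "hd p \<notin> Bad" "last p \<notin> Bad"
    using outside_not_adjacent_hd[OF assms] outside_not_adjacent_last[OF assms] by (auto simp: Bad_def)
  moreover have "successively (\<lambda>x y. \<not> (x \<in> Bad \<and> y \<in> Bad)) p"
    unfolding successively_conv_nth
  proof (intro allI impI notI)
    fix i assume i: "Suc i < length p" and "p ! i \<in> Bad \<and> p ! Suc i \<in> Bad"
    moreover have "p = take i p @ p ! i # p ! Suc i # drop (Suc (Suc i)) p"
      using i by (simp add: Cons_nth_drop_Suc Suc_lessD)
    ultimately show False
      using outside_not_adjacent_consecutive[of "take i p" "p ! i" "p ! Suc i" "drop (Suc (Suc i)) p"] assms
      by (auto simp: Bad_def)
  qed
  moreover have "p \<noteq> []" using p(1) by auto
  ultimately show ?thesis using twice_filter_le_length[of p Bad] by simp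
qed

text \<open>An outside neighbour of a bad vertex now has a partner in \<open>R\<close>, so
  \<open>pendant_edge\<close> leaves exactly two vertices on each side of the bad one. A path with a
  bad vertex therefore has four edges, and only its middle vertex is bad.\<close>

lemma filter_Bad_le_matched:
  assumes "p \<in> set ps" and matched: "\<And>u. u \<in> R \<Longrightarrow> \<exists>u'\<in>R. u \<noteq> u' \<and> E u u'"
  shows "4 * length (filter (\<lambda>x. x \<in> Bad) p) \<le> length p - 1"
proof (cases "filter (\<lambda>x. x \<in> Bad) p = []")
  case False
  then obtain a where a: "a \<in> set p" "a \<in> Bad" by (auto simp: filter_empty_conv)
  have split: "length xs = 2 \<and> length ys = 2" if "p = xs @ b # ys" "b \<in> Bad" for xs b ys
  proof -
    obtain u where u: "u \<in> R" "E u b" using \<open>b \<in> Bad\<close> by (auto simp: Bad_def)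
    obtain u' where "u' \<in> R" "u \<noteq> u'" "E u u'" using matched[OF u(1)] by blast
    then show ?thesis using pendant_edge[of xs b ys u u'] that u assms(1) by blast
  qed
  obtain xs ys where xy: "p = xs @ a # ys" using a(1) by (auto simp: in_set_conv_decomp)
  have len: "length xs = 2" "length ys = 2" using split[OF xy a(2)] by auto
  have "set p \<inter> Bad \<subseteq> {p ! 2}"
  proof
    fix b assume b: "b \<in> set p \<inter> Bad"
    then obtain xs' ys' where "p = xs' @ b # ys'" by (auto simp: in_set_conv_decomp)
    moreover from this have "length xs' = 2" using split b by auto
    ultimately show "b \<in> {p ! 2}" by (simp add: nth_append)
  qed
  then have "card (set p \<inter> Bad) \<le> 1" using card_mono[of "{p ! 2}"] by fastforce
  moreover have "length (filter (\<lambda>x. x \<in> Bad) p) = card (set p \<inter> Bad)"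
    using path(3)[OF assms(1)] by (simp add: Int_def flip: distinct_card)
  ultimately show ?thesis using xy len by simp
qed simp

text \<open>Sums the bounds for single paths; used with \<open>k = 2\<close> in general and
  \<open>k = 4\<close> when the matching covers \<open>R\<close>.\<close>

lemma card_Bad:
  assumes "\<And>p. p \<in> set ps \<Longrightarrow> k * length (filter (\<lambda>x. x \<in> Bad) p) \<le> length p - 1"
  shows "k * card Bad \<le> system_size ps"
proof -
  have "Bad = set (filter (\<lambda>x. x \<in> Bad) (concat ps))" by (auto simp: Bad_def)
  then have "card Bad = length (filter (\<lambda>x. x \<in> Bad) (concat ps))"
    using system by (metis distinct_card distinct_filter path_system_def)
  also have "\<dots> = (\<Sum>p\<leftarrow>ps. length (filter (\<lambda>x. x \<in> Bad) p))"
    by (simp add: filter_concat length_concat comp_def)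
  also have "k * \<dots> = (\<Sum>p\<leftarrow>ps. k * length (filter (\<lambda>x. x \<in> Bad) p))"
    by (simp add: sum_list_const_mult)
  also have "\<dots> \<le> system_size ps"
    unfolding system_size_def by (intro sum_list_mono assms)
  finally show ?thesis .
qed

lemma card_S: "card S = system_size ps + length ps"
proof -
  have "card S = length (concat ps)" using system by (metis distinct_card path_system_def)
  also have "\<dots> = (\<Sum>p\<leftarrow>ps. (length p - 1) + 1)"
    unfolding length_concat using path(1) by (intro arg_cong[of _ _ sum_list] map_cong) fastforce+
  also have "\<dots> = system_size ps + length ps"
    by (simp add: sum_list_Suc system_size_def)
  finally show ?thesis .
qed

lemma twice_length_le: "2 * length ps \<le> system_size ps"
proof -
  have "(\<Sum>p\<leftarrow>ps. 2) \<le> system_size ps"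
    unfolding system_size_def using path(1) by (intro sum_list_mono) fastforce
  then show ?thesis by (simp add: sum_list_triv)
qed

section \<open>The red path and the red kipas\<close>

text \<open>A good vertex of \<open>S\<close> has no \<open>E\<close>-neighbour in \<open>R\<close>,
  so blocks of good vertices fit anywhere into a path through \<open>R - D\<close>. The blocks are
  the first ends, the remaining last ends, and each good inner vertex alone. The first size bound on
  \<open>V\<close> provides enough gaps, the second provides the three vertices that
  \<open>complement_matching_path\<close> asks for.\<close>

lemma complement_path:
  assumes "D \<subseteq> R" "card D \<le> 2" "2 * system_size ps + 4 \<le> card V"
    and "3 + system_size ps + length ps + card D \<le> card V"
  obtains zs where "distinct zs" "set zs = V - Bad - D" "successively (\<lambda>x y. \<not> E x y) zs"
proof -
  define A where "A = hd ` set ps"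
  define B where "B = last ` set ps"
  define J where "J = S - Bad - A - B"
  have SV: "S \<subseteq> V" using system by (simp add: path_system_def)
  have ne: "p \<noteq> []" if "p \<in> set ps" for p using path(1)[OF that] by auto
  have AS: "A \<subseteq> S - Bad" "B \<subseteq> S - Bad"
  proof -
    have "hd p \<in> S - Bad" "last p \<in> S - Bad" if "p \<in> set ps" for p
      using path(5)[OF that] hd_in_set[OF ne] last_in_set[OF ne] that
        outside_not_adjacent_hd[OF that] outside_not_adjacent_last[OF that] unfolding Bad_def by blast+
    then show "A \<subseteq> S - Bad" "B \<subseteq> S - Bad" unfolding A_def B_def by blast+
  qed
  have finA: "finite A" "finite B" "finite J" by (auto simp: A_def B_def J_def)
  have RD: "card (R - D) = card V - (system_size ps + length ps) - card D"
    using SV finV assms(1) finite_subset[OF assms(1)]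
    by (simp add: card_Diff_subset card_S del: set_concat)
  \<comment> \<open>A path has one inner vertex fewer than it has edges; summing over
    \<open>ps\<close> gives the bound, written without subtraction.\<close>
  have J: "card J + length ps \<le> system_size ps"
  proof -
    have "J \<subseteq> set (concat (map (\<lambda>p. butlast (tl p)) ps))"
    proof
      fix x assume x: "x \<in> J"
      then obtain p where p: "p \<in> set ps" "x \<in> set p" by (auto simp: J_def)
      have "x \<noteq> hd p" "x \<noteq> last p" using x p(1) by (auto simp: J_def A_def B_def)
      then have "x \<in> set (butlast (tl p))"
        using p(2) ne[OF p(1)] by (cases p; cases "tl p" rule: rev_cases) auto
      then show "x \<in> set (concat (map (\<lambda>p. butlast (tl p)) ps))" using p(1) by auto
    qed
    then have "card J \<le> length (concat (map (\<lambda>p. butlast (tl p)) ps))"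
      by (meson card_length card_mono finite_set order_trans)
    also have "\<dots> = (\<Sum>p\<leftarrow>ps. length p - 2)" by (simp add: length_concat comp_def numeral_2_eq_2)
    also have "\<dots> + length ps = (\<Sum>p\<leftarrow>ps. (length p - 2) + 1)"
      by (simp add: sum_list_Suc)
    also have "\<dots> = system_size ps"
      unfolding system_size_def using path(1)
      by (intro arg_cong[of _ _ sum_list] map_cong) fastforce+
    finally show ?thesis by simp
  qed
  have "\<exists>us. distinct us \<and> set us = R - D \<and> successively (\<lambda>x y. \<not> E x y) us"
  proof (rule complement_matching_path)
    show "3 \<le> card (R - D)" using RD assms(4) by simp
    show "finite (R - D)" using finV by simp
  qed (use outside_matching sym in auto)
  then obtain us where us: "distinct us" "set us = R - D" "successively (\<lambda>x y. \<not> E x y) us"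
    by blast
  obtain as where as: "distinct as" "set as = A" using finite_distinct_list[OF finA(1)] by blast
  \<comment> \<open>Taking \<open>B - A\<close> makes the blocks disjoint by construction.\<close>
  obtain bs where bs: "distinct bs" "set bs = B - A" using finite_distinct_list[of "B - A"] finA by blast
  obtain js where js: "distinct js" "set js = J" using finite_distinct_list[OF finA(3)] by blast
  have indep: "successively (\<lambda>x y. \<not> E x y) xs"
    if "distinct xs" "\<And>x y. x \<in> set xs \<Longrightarrow> y \<in> set xs \<Longrightarrow> x \<noteq> y \<Longrightarrow> \<not> E x y" for xs
    unfolding successively_conv_nth using that by (auto simp: nth_eq_iff_index_eq)
  have "successively (\<lambda>x y. \<not> E x y) as"
    by (rule indep[OF as(1)]) (use as(2) ends_not_adjacent(1) in \<open>auto simp: A_def\<close>)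
  moreover have "successively (\<lambda>x y. \<not> E x y) bs"
    by (rule indep[OF bs(1)]) (use bs(2) ends_not_adjacent(2) in \<open>auto simp: B_def\<close>)
  moreover define blocks where "blocks = as # bs # map (\<lambda>j. [j]) js"
  ultimately have succ: "successively (\<lambda>x y. \<not> E x y) b" if "b \<in> set blocks" for b
    using that by auto
  have cb: "concat blocks = as @ bs @ js" by (simp add: blocks_def concat_map_singleton)
  have sb: "set (concat blocks) = S - Bad" "distinct (concat blocks)"
    using as bs js AS unfolding cb by (auto simp: J_def)
  have "length us = card (R - D)" "length js = card J" using us js by (metis distinct_card)+
  \<comment> \<open>With \<open>s = system_size ps\<close> and \<open>l = length ps\<close> there
    are at most \<open>s - l + 2\<close> blocks, while \<open>card V \<ge> 2 * s + 4\<close> and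
    \<open>card D \<le> 2\<close> leave at least \<open>s - l + 2\<close> vertices in
    \<open>R - D\<close>.\<close>
  then have "length blocks \<le> length us"
    using RD J assms(2-4) by (simp add: blocks_def)
  then have "\<exists>zs. mset zs = mset us + mset (concat blocks) \<and> successively (\<lambda>x y. \<not> E x y) zs"
  proof (rule interleave)
    fix u w assume "u \<in> set us" "w \<in> set (concat blocks)"
    then have "\<not> E u w" unfolding sb us(2) Bad_def by blast
    then show "\<not> E u w \<and> \<not> E w u" using sym by blast
  qed (use us(3) succ in auto)
  then obtain zs where zs: "mset zs = mset (us @ concat blocks)" "successively (\<lambda>x y. \<not> E x y) zs"
    by auto
  have "set us \<inter> set (concat blocks) = {}" unfolding sb us(2) by blast
  then have "distinct (us @ concat blocks)" using us(1) sb(2) by simp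
  then have "distinct zs" using mset_eq_imp_distinct_iff[OF zs(1)] by simp
  moreover have "set zs = set us \<union> set (concat blocks)" using mset_eq_setD[OF zs(1)] by simp
  then have "set zs = V - Bad - D" unfolding sb us(2) using SV assms(1) by (auto simp: Bad_def)
  ultimately show ?thesis using that zs(2) by blast
qed


text \<open>The center \<open>v\<close> is an outside vertex, and \<open>D\<close> consists of
  \<open>v\<close> and its partner, if it has one. The crux is that \<open>card Bad + card D\<close>
  is at most the surplus \<open>(m + 1) div 2\<close> of \<open>card V\<close> over
  \<open>n\<close>. An unmatched \<open>v\<close> costs one vertex besides at most
  \<open>s / 2\<close> bad ones, where \<open>s = system_size ps\<close>; if all of \<open>R\<close>
  is matched, \<open>v\<close> costs two, but then at most \<open>s / 4\<close> are bad.\<close>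

lemma kipas_in_complement:
  assumes "3 \<le> m" "system_size ps < m" "2 * m \<le> n" "card V = n + (m + 1) div 2"
  obtains v zs where "v \<in> V" "length zs = n" "distinct zs" "set zs \<subseteq> V - {v}"
    "successively (\<lambda>x y. \<not> E x y) zs" "\<And>z. z \<in> set zs \<Longrightarrow> \<not> E v z"
proof -
  have "card S < card V" using card_S twice_length_le assms by linarith
  then have "\<not> V \<subseteq> S" using card_mono[of S V] by auto
  then obtain v0 where v0: "v0 \<in> R" by blast
  obtain v D where D: "v \<in> D" "D \<subseteq> R" "card D \<le> 2" "card Bad + card D \<le> (m + 1) div 2"
    and vD: "\<And>z. z \<in> R - D \<Longrightarrow> \<not> E v z"
  proof (cases "\<exists>v\<in>R. \<forall>u\<in>R. v \<noteq> u \<longrightarrow> \<not> E v u")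
    case True
    then obtain v where v: "v \<in> R" "\<And>u. u \<in> R \<Longrightarrow> v \<noteq> u \<Longrightarrow> \<not> E v u" by blast
    have "2 * card Bad \<le> system_size ps" by (intro card_Bad filter_Bad_le)
    then have "card Bad + card {v} \<le> (m + 1) div 2" using assms(2) by simp
    then show ?thesis using that[of v "{v}"] v by auto
  next
    case False
    then have matched: "\<exists>u'\<in>R. u \<noteq> u' \<and> E u u'" if "u \<in> R" for u using that by blast
    obtain v' where v': "v' \<in> R" "v0 \<noteq> v'" "E v0 v'" using matched[OF v0] by blast
    have "4 * card Bad \<le> system_size ps" by (intro card_Bad filter_Bad_le_matched matched)
    \<comment> \<open>This uses integrality: for \<open>m = 3\<close> and \<open>m = 4\<close> the
      bound \<open>4 * card Bad < m\<close> forces \<open>card Bad = 0\<close>.\<close>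
    then have "2 * (card Bad + 2) \<le> m + 1"
      using assms(1,2) by arith
    then have "card Bad + card {v0, v'} \<le> (m + 1) div 2" using v'(2) by simp
    moreover have "\<not> E v0 z" if "z \<in> R - {v0, v'}" for z
      using outside_matching[of v0 v' z] that v0 v' by blast
    ultimately show ?thesis using that[of v0 "{v0, v'}"] v0 v' by auto
  qed
  have "2 * system_size ps + 4 \<le> card V" using assms by linarith
  \<comment> \<open>For \<open>m = 3\<close> there is no slack: at most two edges, one path and two
    vertices in \<open>D\<close> make the left side at most 8, and \<open>card V\<close> is at least
    6 + 2.\<close>
  moreover have "3 + system_size ps + length ps + card D \<le> card V"
    using twice_length_le assms D(3) by (cases "m = 3") linarith+
  ultimately obtain zs where zs: "distinct zs" "set zs = V - Bad - D" "successively (\<lambda>x y. \<not> E x y) zs"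
    using complement_path[OF D(2,3)] by blast
  have Bad: "Bad \<subseteq> V" using system by (auto simp: Bad_def path_system_def)
  have "length zs = card (V - Bad - D)" using zs by (metis distinct_card)
  also have "\<dots> \<ge> card V - card Bad - card D"
    using finV Bad D(2) by (meson diff_card_le_card_Diff diff_le_mono finite_subset order_trans Diff_subset)
  finally have n: "n \<le> length zs" using D(4) assms(4) by linarith
  have tk: "set (take n zs) \<subseteq> V - Bad - D" using set_take_subset[of n zs] zs(2) by simp
  show ?thesis
  proof
    show "v \<in> V" using D by blast
    show "length (take n zs) = n" "distinct (take n zs)" using n zs(1) by simp_all
    show "set (take n zs) \<subseteq> V - {v}" using tk D(1) by blast
    show "successively (\<lambda>x y. \<not> E x y) (take n zs)"
      using zs(3) successively_append_iff[of _ "take n zs" "drop n zs"] by simp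
    show "\<not> E v z" if "z \<in> set (take n zs)" for z
    proof (cases "z \<in> S")
      case True
      then have "z \<notin> Bad" using tk that by blast
      then show ?thesis using True D(1,2) unfolding Bad_def by blast
    next
      case False
      then show ?thesis using vD[of z] tk that by blast
    qed
  qed
qed

end

section \<open>The upper bounds and the Ramsey numbers\<close>

lemma ramsey_upper:
  assumes "3 \<le> m" "2 * m \<le> n"
  shows "ramsey_arrow (n + (m + 1) div 2) (kipas n)
    {L :: nat graph. k_linear_forest 3 L \<and> m \<le> num_edges L}"
  unfolding ramsey_arrow_def
proof (intro allI)
  fix c :: "nat set \<Rightarrow> colour"
  let ?N = "n + (m + 1) div 2" and ?E = "\<lambda>x y. c {x, y} = Blue"
  let ?G = "colour_subgraph (complete_graph ?N) c"
  let ?sys = "path_system ?E {..<?N} 3"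
  show "has_copy (?G Red) (kipas n) \<or>
    (\<exists>L\<in>{L :: nat graph. k_linear_forest 3 L \<and> m \<le> num_edges L}. has_copy (?G Blue) L)"
  proof (cases "\<exists>ps. ?sys ps \<and> m \<le> system_size ps")
    case True
    then obtain ps where ps: "?sys ps" "m \<le> system_size ps" by blast
    obtain L :: "nat graph" where "k_linear_forest 3 L" "num_edges L = system_size ps"
      "has_copy (?G Blue) L"
      by (rule has_copy_path_system[OF ps(1)]) auto
    then show ?thesis using ps(2) by auto
  next
    case False
    moreover have "?sys []" by (simp add: path_system_def)
    \<comment> \<open>All sizes are below \<open>m\<close> and the empty system qualifies, so a
      system of maximal size exists.\<close>
    ultimately obtain ps where ps: "?sys ps" "\<And>qs. ?sys qs \<Longrightarrow> system_size qs \<le> system_size ps"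
      using ex_has_greatest_nat[of ?sys "[]" system_size m] by (meson not_le)
    have "system_size ps < m" using False ps(1) by (meson not_le)
    interpret optimal_system ?E "{..<?N}" ps
      by unfold_locales (use ps in \<open>auto simp: insert_commute\<close>)
    obtain v zs where vz: "v \<in> {..<?N}" "length zs = n" "distinct zs" "set zs \<subseteq> {..<?N} - {v}"
      "successively (\<lambda>x y. c {x, y} \<noteq> Blue) zs" "\<And>z. z \<in> set zs \<Longrightarrow> c {v, z} \<noteq> Blue"
      by (rule kipas_in_complement[OF assms(1) \<open>system_size ps < m\<close> assms(2)]) auto
    have red: "c e \<noteq> Blue \<longleftrightarrow> c e = Red" for e by (cases "c e") auto
    have "has_copy (?G Red) (kipas n)"
      using vz unfolding red by (intro has_copy_kipas[of zs n ?N v]) auto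
    then show ?thesis ..
  qed
qed

lemma ramsey_upper_2:
  assumes "4 \<le> n"
  shows "ramsey_arrow (n + 1) (kipas n) {L :: nat graph. linear_forest L \<and> 2 \<le> num_edges L}"
  unfolding ramsey_arrow_def
proof (intro allI)
  fix c :: "nat set \<Rightarrow> colour"
  let ?V = "{..<n + 1}" and ?E = "\<lambda>x y. c {x, y} = Blue"
  let ?G = "colour_subgraph (complete_graph (n + 1)) c"
  let ?sys = "path_system ?E ?V 2"
  show "has_copy (?G Red) (kipas n) \<or>
    (\<exists>L\<in>{L :: nat graph. linear_forest L \<and> 2 \<le> num_edges L}. has_copy (?G Blue) L)"
  proof (cases "\<exists>ps. ?sys ps \<and> 2 \<le> system_size ps")
    case True
    then obtain ps where ps: "?sys ps" "2 \<le> system_size ps" by blast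
    obtain L :: "nat graph" where "k_linear_forest 2 L" "num_edges L = system_size ps"
      "has_copy (?G Blue) L"
      by (rule has_copy_path_system[OF ps(1)]) auto
    then show ?thesis using ps(2) by (auto simp: k_linear_forest_def linear_forest_def)
  next
    case False
    have sym: "?E x y \<longleftrightarrow> ?E y x" for x y by (simp add: insert_commute)
    have match: "y = z"
      if "x \<in> ?V" "y \<in> ?V" "z \<in> ?V" "x \<noteq> y" "x \<noteq> z" "?E x y" "?E x z" for x y z
    proof (rule ccontr)
      assume "y \<noteq> z"
      then have "?sys [[y, x, z]]" using that sym[of x y] by (auto simp: path_system_def)
      then show False using False by (force simp: system_size_def)
    qed
    have single: "{x, y} \<inter> {a, b} \<noteq> {}"
      if "x \<in> ?V" "y \<in> ?V" "a \<in> ?V" "b \<in> ?V" "x \<noteq> y" "a \<noteq> b" "?E x y" "?E a b" for x y a b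
    proof
      assume "{x, y} \<inter> {a, b} = {}"
      then have "?sys [[x, y], [a, b]]" using that by (auto simp: path_system_def)
      then show False using False by (force simp: system_size_def)
    qed
    obtain v where v: "v \<in> ?V" "\<And>z. z \<in> ?V \<Longrightarrow> z \<noteq> v \<Longrightarrow> \<not> ?E v z"
    proof (cases "\<exists>a\<in>?V. \<exists>b\<in>?V. a \<noteq> b \<and> ?E a b")
      case True
      then obtain a b where ab: "a \<in> ?V" "b \<in> ?V" "a \<noteq> b" "?E a b" by blast
      have "\<not> ?V \<subseteq> {a, b}" using card_mono[of "{a, b}" ?V] assms ab(3) by auto
      then obtain v where v: "v \<in> ?V" "v \<noteq> a" "v \<noteq> b" by blast
      have "\<not> ?E v z" if z: "z \<in> ?V" "z \<noteq> v" for z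
      proof
        assume vz: "?E v z"
        then have "z = a \<or> z = b" using single[of v z a b] z ab v by auto
        then show False
          using match[of a b v] match[of b a v] ab v vz sym[of v z] sym[of a b] by auto
      qed
      then show ?thesis using that v(1) by blast
    next
      case False
      have "0 \<in> ?V" by simp
      then have "\<And>z. z \<in> ?V \<Longrightarrow> z \<noteq> 0 \<Longrightarrow> \<not> ?E 0 z" using False by metis
      with \<open>0 \<in> ?V\<close> show ?thesis by (rule that)
    qed
    have "\<exists>zs. distinct zs \<and> set zs = ?V - {v} \<and> successively (\<lambda>x y. \<not> ?E x y) zs"
    proof (rule complement_matching_path)
      show "3 \<le> card (?V - {v})" using assms v(1) by simp
    qed (use match sym in auto)
    then obtain zs where zs: "distinct zs" "set zs = ?V - {v}"
      "successively (\<lambda>x y. c {x, y} \<noteq> Blue) zs" by blast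
    have "length zs = n" using zs(1,2) v(1) distinct_card[OF zs(1)] by simp
    moreover have "c {v, z} \<noteq> Blue" if "z \<in> set zs" for z using v(2) that zs(2) by auto
    moreover have red: "c e \<noteq> Blue \<longleftrightarrow> c e = Red" for e by (cases "c e") auto
    ultimately have "has_copy (?G Red) (kipas n)"
      using zs v(1) unfolding red by (intro has_copy_kipas[of zs n "n + 1" v]) auto
    then show ?thesis ..
  qed
qed

lemma ramsey_arrow_mono:
  assumes "ramsey_arrow N G F" "F \<subseteq> F'"
  shows "ramsey_arrow N G F'"
  using assms unfolding ramsey_arrow_def by blast

theorem theorem1p6:
  fixes m n :: nat
  shows "(2 \<le> m \<and> real m \<le> real n / 2 \<longrightarrow>
           ramsey_number (kipas n) {L :: nat graph. linear_forest L \<and> num_edges L \<ge> m}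
             = enat (n + nat \<lceil>real m / 2\<rceil>)) \<and>
         (6 \<le> m \<and> real m \<le> real n / 2 \<longrightarrow>
           ramsey_number (kipas n) {L :: nat graph. k_linear_forest 3 L \<and> num_edges L \<ge> m}
             = enat (n + nat \<lceil>real m / 2\<rceil>))"
proof -
  let ?F = "{L :: nat graph. linear_forest L \<and> m \<le> num_edges L}"
  let ?F3 = "{L :: nat graph. k_linear_forest 3 L \<and> m \<le> num_edges L}"
  have ceil: "nat \<lceil>real m / 2\<rceil> = (m + 1) div 2"
  proof -
    have "\<lceil>real m / 2\<rceil> = int ((m + 1) div 2)"
      by (rule ceiling_unique) (cases "even m"; auto elim!: evenE oddE)+
    then show ?thesis by simp
  qed
  have sub: "?F3 \<subseteq> ?F" by (auto simp: k_linear_forest_def linear_forest_def)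
  have lower: "n + (m + 1) div 2 \<le> M"
    if "2 \<le> m" "2 * m \<le> n" "ramsey_arrow M (kipas n) F" "F \<subseteq> ?F" for M F
    by (rule ramsey_lower[OF _ _ _ that(3)]) (use that in auto)
  have "ramsey_number (kipas n) ?F = enat (n + (m + 1) div 2)" if m: "2 \<le> m" "2 * m \<le> n"
  proof -
    have "ramsey_arrow (n + (m + 1) div 2) (kipas n) ?F"
    proof (cases "m = 2")
      case True
      then show ?thesis using ramsey_upper_2[of n] m by simp
    next
      case False
      then show ?thesis using ramsey_arrow_mono[OF ramsey_upper sub] m by simp
    qed
    then show ?thesis using lower[OF m] unfolding ramsey_number_eq_enat_iff by blast
  qed
  moreover have "ramsey_number (kipas n) ?F3 = enat (n + (m + 1) div 2)"
    if m: "6 \<le> m" "2 * m \<le> n"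
  proof -
    have "2 \<le> m" "3 \<le> m" using m by simp_all
    then show ?thesis
      using ramsey_upper[of m n] lower[OF _ m(2) _ sub] m(2)
      unfolding ramsey_number_eq_enat_iff by blast
  qed
  ultimately show ?thesis unfolding ceil by auto
qed

end
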